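(* Let $[\underline\theta,\bar\theta]$ be an interval such that $\mathcal{P}^{\mathrm{SDP\text{-}bd}}(\theta)$ is feasible for every $\theta\in[\underline\theta,\bar\theta]$. Let $\theta\in[\underline\theta,\bar\theta]$ and let $\Psi^*$ be an optimal solution of $\mathcal{P}^{\mathrm{SDP\text{-}dual}}(\theta)$. Write $f^{\mathrm d}_\theta(\Psi^*,\theta)$ for the partial derivative of $f^{\mathrm d}(\Psi,\theta)$ with respect to $\theta$ at $(\Psi^*,\theta)$. Then: (i) if $\theta>\underline\theta$ and $V^{\mathrm{SDP}}$ is left differentiable at $\theta$, then its left derivative satisfies $V^{\mathrm{SDP}\prime}(\theta-)\le f^{\mathrm d}_\theta(\Psi^*,\theta)$; (ii) if $\theta<\bar\theta$ and $V^{\mathrm{SDP}}$ is right differentiable at $\theta$, then its right derivative satisfies $V^{\mathrm{SDP}\prime}(\theta+)\ge f^{\mathrm d}_\theta(\Psi^*,\theta)$; (iii) if $\theta\in[\underline\theta,\bar\theta]$ and $V^{\mathrm{SDP}}$ is differentiable at $\theta$, then $V^{\mathrm{SDP}\prime}(\theta)=f^{\mathrm d}_\theta(\Psi^*,\theta)$.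
   Context: Data: integers $n,m\ge 1$, a symmetric positive semidefinite matrix $Q\in\mathbb{R}^{n\times n}$, $c\in\mathbb{R}^n$, $a_1,\dots,a_m\in\mathbb{R}^n$, a set $\mathcal{B}\subseteq[n]=\{1,\dots,n\}$, and differentiable functions $b_1,\dots,b_m:\mathbb{R}\to\mathbb{R}$ of a scalar parameter $\theta$. For matrices, $\succeq 0$ means symmetric positive semidefinite and $\ge 0$ means entrywise nonnegative. $\mathcal{P}^{\mathrm{MBQP}}(\theta)$: minimize $x^\top Qx+c^\top x$ over $x\in\mathbb{R}^n_+$ subject to $a_j^\top x=b_j(\theta)$ for all $j$ and $x_i\in\{0,1\}$ for $i\in\mathcal{B}$. Standing assumption: for each $i\in[n]\setminus\mathcal{B}$ there is a finite $U_i$ such that every feasible $x$ satisfies $x_i\le U_i$. $\mathcal{P}^{\mathrm{SDP\text{-}bd}}(\theta)$: minimize $\mathrm{Tr}(Q^\top X)+c^\top x$ over $x\in\mathbb{R}^n$ and symmetric $X\in\mathbb{R}^{n\times n}$, with $Y:=\begin{bmatrix}1 & x^\top \\ x & X\end{bmatrix}$, subject to: $a_j^\top x=b_j(\theta)$ and $\mathrm{Tr}(a_ja_j^\top X)=b_j(\theta)^2$ for $j=1,\dots,m$; $X_{ii}\le U_i^2$ for $i\in[n]\setminus\mathcal{B}$; $x_i=X_{ii}$ for $i\in\mathcal{B}$; $Y\succeq 0$; $Y\ge 0$. Its optimal value is the primal value function $V^{\mathrm{SDP}}(\theta)$. $\mathcal{P}^{\mathrm{SDP\text{-}dual}}(\theta)$: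 maximize $$f^{\mathrm d}(\Psi,\theta):=\sum_{j=1}^m\big(\gamma_jb_j(\theta)+\omega_jb_j(\theta)^2\big)+\mu+\sum_{i\in[n]\setminus\mathcal{B}}U_i^2\phi_i$$ over tuples $\Psi=(\gamma,\omega,\phi,\kappa,\mu,\Omega,\Theta)$ with $\gamma,\omega\in\mathbb{R}^m$, $\kappa\in\mathbb{R}^{\mathcal{B}}$, $\phi\in\mathbb{R}^{[n]\setminus\mathcal{B}}$, $\phi\le 0$, $\mu\in\mathbb{R}$, and symmetric $(n+1)\times(n+1)$ matrices $\Theta\ge 0$, $\Omega\succeq 0$, subject to $$C-\sum_{j}\gamma_jA_j-\sum_j\omega_j\hat A_j-\sum_{i\in\mathcal{B}}\kappa_iB_i-\sum_{i\in[n]\setminus\mathcal{B}}\phi_iG_i-\mu H=\Theta+\Omega,$$ where, $e_i$ denoting the $i$-th unit vector of $\mathbb{R}^n$, $C=\begin{bmatrix}0&\frac12c^\top \\ \frac12c&Q\end{bmatrix}$, $A_j=\begin{bmatrix}0&\frac12a_j^\top \\ \frac12a_j&0\end{bmatrix}$, $\hat A_j=\begin{bmatrix}0&0 \\ 0&a_ja_j^\top\end{bmatrix}$, $B_i=\begin{bmatrix}0&\frac12e_i^\top \\ \frac12e_i&-e_ie_i^\top\end{bmatrix}$, $G_i=\begin{bmatrix}0&0 \\ 0&e_ie_i^\top\end{bmatrix}$, $H=\begin{bmatrix}1&0 \\ 0&0\end{bmatrix}$. This feasible set does not depend on $\theta$. Convention: "differentiable at $\theta$" means that the two-sided derivative at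 $\theta$ exists (with $V^{\mathrm{SDP}}$ finite near $\theta$). *)

theory Defs
  imports "HOL-Analysis.Analysis"
begin

text \<open>
  The index set \<open>[n]\<close> is a finite type \<open>'n\<close>, the constraint index set a finite type \<open>'m\<close>.
  Matrices of size \<open>n + 1\<close> are indexed by \<open>'n option\<close>, where \<open>None\<close> is the additional first
  index.
\<close>

definition psd :: "real^'k^'k \<Rightarrow> bool" where
  "psd A \<longleftrightarrow> transpose A = A \<and> (\<forall>v. 0 \<le> v \<bullet> (A *v v))"

definition nonneg_mat :: "real^'k^'k \<Rightarrow> bool" where
  "nonneg_mat A \<longleftrightarrow> (\<forall>i j. 0 \<le> A $ i $ j)"

definition outer :: "real^'n \<Rightarrow> real^'n^'n" where
  "outer v = (\<chi> i j. v $ i * v $ j)"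

text \<open>\<open>bordered \<alpha> v M\<close> is the symmetric block matrix with corner \<open>\<alpha>\<close>, border \<open>v\<close> and
  lower right block \<open>M\<close>.\<close>

definition bordered :: "real \<Rightarrow> real^'n \<Rightarrow> real^'n^'n \<Rightarrow> real^('n option)^('n option)" where
  "bordered \<alpha> v M = (\<chi> i j. case (i, j) of
      (None, None) \<Rightarrow> \<alpha>
    | (None, Some l) \<Rightarrow> v $ l
    | (Some k, None) \<Rightarrow> v $ k
    | (Some k, Some l) \<Rightarrow> M $ k $ l)"


section \<open>The mixed-binary program and its relaxation\<close>

definition mbqp_feasible ::
  "('m::finite \<Rightarrow> real^'n) \<Rightarrow> ('m \<Rightarrow> real \<Rightarrow> real) \<Rightarrow> 'n set \<Rightarrow> real \<Rightarrow> real^'n \<Rightarrow> bool" where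
  "mbqp_feasible a b B \<theta> x \<longleftrightarrow>
     (\<forall>i. 0 \<le> x $ i) \<and> (\<forall>j. a j \<bullet> x = b j \<theta>) \<and> (\<forall>i\<in>B. x $ i \<in> {0, 1})"

definition sdp_feasible ::
  "('m::finite \<Rightarrow> real^'n) \<Rightarrow> ('m \<Rightarrow> real \<Rightarrow> real) \<Rightarrow> 'n set \<Rightarrow> ('n \<Rightarrow> real) \<Rightarrow> real \<Rightarrow>
   real^'n \<Rightarrow> real^'n^'n \<Rightarrow> bool" where
  "sdp_feasible a b B U \<theta> x X \<longleftrightarrow>
     transpose X = X \<and>
     (\<forall>j. a j \<bullet> x = b j \<theta>) \<and>
     (\<forall>j. trace (outer (a j) ** X) = (b j \<theta>)\<^sup>2) \<and>
     (\<forall>i\<in>-B. X $ i $ i \<le> (U i)\<^sup>2) \<and>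
     (\<forall>i\<in>B. x $ i = X $ i $ i) \<and>
     psd (bordered 1 x X) \<and> nonneg_mat (bordered 1 x X)"

definition sdp_objective :: "real^'n^'n \<Rightarrow> real^'n \<Rightarrow> real^'n \<Rightarrow> real^'n^'n \<Rightarrow> real" where
  "sdp_objective Q c x X = trace (transpose Q ** X) + c \<bullet> x"

text \<open>The value is \<open>\<infinity>\<close> at infeasible parameters.\<close>

definition sdp_value ::
  "real^'n^'n \<Rightarrow> real^'n \<Rightarrow> ('m::finite \<Rightarrow> real^'n) \<Rightarrow> ('m \<Rightarrow> real \<Rightarrow> real) \<Rightarrow> 'n set \<Rightarrow>
   ('n \<Rightarrow> real) \<Rightarrow> real \<Rightarrow> ereal" where
  "sdp_value Q c a b B U \<theta> =
     (INF (x, X)\<in>{(x, X). sdp_feasible a b B U \<theta> x X}. ereal (sdp_objective Q c x X))"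


section \<open>The dual program\<close>

text \<open>
  Dual variables are tuples \<open>(\<gamma>, \<omega>, \<phi>, \<kappa>, \<mu>, \<Omega>, \<Theta>)\<close>. The vectors \<open>\<phi>\<close> and \<open>\<kappa>\<close> live on \<open>-B\<close> and
  \<open>B\<close>; they are represented by vectors over all of \<open>'n\<close> whose other entries occur nowhere below.
\<close>

type_synonym ('n, 'm) dual_vars =
  "(real^'m) \<times> (real^'m) \<times> (real^'n) \<times> (real^'n) \<times> real \<times>
   (real^('n option)^('n option)) \<times> (real^('n option)^('n option))"

fun dual_feasible ::
  "real^'n^'n \<Rightarrow> real^'n \<Rightarrow> ('m::finite \<Rightarrow> real^'n) \<Rightarrow> 'n set \<Rightarrow> ('n, 'm) dual_vars \<Rightarrow> bool" where
  "dual_feasible Q c a B (\<gamma>, \<omega>, \<phi>, \<kappa>, \<mu>, \<Omega>, \<Theta>) \<longleftrightarrow>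
     (\<forall>i\<in>-B. \<phi> $ i \<le> 0) \<and>
     transpose \<Theta> = \<Theta> \<and> nonneg_mat \<Theta> \<and> psd \<Omega> \<and>
     bordered 0 ((1/2) *\<^sub>R c) Q
       - (\<Sum>j\<in>UNIV. \<gamma> $ j *\<^sub>R bordered 0 ((1/2) *\<^sub>R a j) 0)
       - (\<Sum>j\<in>UNIV. \<omega> $ j *\<^sub>R bordered 0 0 (outer (a j)))
       - (\<Sum>i\<in>B. \<kappa> $ i *\<^sub>R bordered 0 ((1/2) *\<^sub>R axis i 1) (- outer (axis i 1)))
       - (\<Sum>i\<in>-B. \<phi> $ i *\<^sub>R bordered 0 0 (outer (axis i 1)))
       - \<mu> *\<^sub>R bordered 1 0 0
     = \<Theta> + \<Omega>"

fun dual_objective ::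
  "('m::finite \<Rightarrow> real \<Rightarrow> real) \<Rightarrow> 'n set \<Rightarrow> ('n \<Rightarrow> real) \<Rightarrow> ('n::finite, 'm) dual_vars \<Rightarrow>
   real \<Rightarrow> real" where
  "dual_objective b B U (\<gamma>, \<omega>, \<phi>, \<kappa>, \<mu>, \<Omega>, \<Theta>) \<theta> =
     (\<Sum>j\<in>UNIV. \<gamma> $ j * b j \<theta> + \<omega> $ j * (b j \<theta>)\<^sup>2) + \<mu> + (\<Sum>i\<in>-B. (U i)\<^sup>2 * \<phi> $ i)"

definition dual_optimal ::
  "real^'n^'n \<Rightarrow> real^'n \<Rightarrow> ('m::finite \<Rightarrow> real^'n) \<Rightarrow> ('m \<Rightarrow> real \<Rightarrow> real) \<Rightarrow> 'n set \<Rightarrow>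
   ('n \<Rightarrow> real) \<Rightarrow> real \<Rightarrow> ('n, 'm) dual_vars \<Rightarrow> bool" where
  "dual_optimal Q c a b B U \<theta> \<Psi> \<longleftrightarrow>
     dual_feasible Q c a B \<Psi> \<and>
     (\<forall>\<Psi>'. dual_feasible Q c a B \<Psi>' \<longrightarrow> dual_objective b B U \<Psi>' \<theta> \<le> dual_objective b B U \<Psi> \<theta>)"


section \<open>Derivatives of extended real valued functions\<close>

text \<open>
  Since \<open>real_of_ereal\<close> maps infinite values to 0, finiteness near \<open>t\<close> (within \<open>S\<close>) has to be
  required explicitly. The left, right and two-sided derivatives are the cases \<open>S = {..t}\<close>,
  \<open>S = {t..}\<close> and \<open>S = UNIV\<close>.
\<close>

definition has_finite_derivative_within :: "(real \<Rightarrow> ereal) \<Rightarrow> real \<Rightarrow> real \<Rightarrow> real set \<Rightarrow> bool" where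
  "has_finite_derivative_within V D t S \<longleftrightarrow>
     (\<exists>\<epsilon>>0. \<forall>s\<in>S. \<bar>s - t\<bar> < \<epsilon> \<longrightarrow> \<bar>V s\<bar> \<noteq> \<infinity>) \<and>
     ((\<lambda>s. real_of_ereal (V s)) has_real_derivative D) (at t within S)"

end

theory Submission
  imports Defs
begin

text \<open>
  The dual feasible set does not depend on the parameter. Hence weak duality, applied to the one
  point \<open>\<Psi>\<close> at every parameter \<open>s\<close>, says that the differentiable function \<open>dual_objective b B U \<Psi>\<close>
  lies below the value function everywhere (\<open>dual_objective_le_sdp_value\<close>). If the two agree at
  \<open>\<theta>\<close>, then their difference is nonnegative and vanishes at \<open>\<theta>\<close>, so its left derivative is at
  most \<open>0\<close> and its right derivative at least \<open>0\<close>, which are the three claims.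

  Agreement at \<open>\<theta>\<close> is strong duality (\<open>sdp_value_eq_dual_optimum\<close>). Consider the convex cone of
  all pairs of a matrix \<open>dual_matrix a B \<Psi>'\<close> and a number at most
  \<open>dual_objective b B U \<Psi>' \<theta>\<close>, where \<open>\<Psi>'\<close> satisfies the sign constraints, and let \<open>C\<close> be the
  cost matrix. If \<open>r\<close> exceeds the dual optimum, then \<open>(C, r)\<close> is outside this cone, and a
  separating normal is, up to scaling, a primal feasible matrix with objective at most \<open>r\<close>. The
  scaling could only fail for a normal that is a direction of recession of the primal feasible set,
  but this set is bounded and has none.

  The one fact about semidefinite matrices behind weak duality is \<open>psd_inner_nonneg\<close>; it is proved
  by elimination instead of spectral decomposition.
\<close>

section \<open>Positive semidefinite matrices\<close>

lemma inner_matrix_sum: "A \<bullet> B = (\<Sum>i\<in>UNIV. \<Sum>j\<in>UNIV. A $ i $ j * B $ i $ j)"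
  for A B :: "real^'l^'k"
  by (simp add: inner_vec_def)

lemma transpose_nth: "transpose A $ i $ j = A $ j $ i"
  by (simp add: transpose_def)

lemma linear_transpose: "linear (transpose :: real^'k^'k \<Rightarrow> real^'k^'k)"
  by (rule linearI) (simp_all add: vec_eq_iff transpose_nth)

lemma inner_transpose_transpose: "transpose A \<bullet> transpose B = A \<bullet> B"
  for A B :: "real^'k^'k"
  unfolding inner_matrix_sum transpose_def by (simp, rule sum.swap)

lemma transpose_outer [simp]: "transpose (outer v) = outer v"
  by (simp add: transpose_def outer_def vec_eq_iff mult.commute)

lemma outer_mult_vector: "outer v *v w = (v \<bullet> w) *\<^sub>R v"
  by (simp add: outer_def matrix_vector_mult_def vec_eq_iff inner_vec_def
      sum_distrib_left sum_distrib_right mult_ac)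

lemma inner_outer: "outer v \<bullet> A = v \<bullet> (A *v v)"
  unfolding inner_matrix_sum
  by (simp add: outer_def matrix_vector_mult_def inner_vec_def sum_distrib_left mult_ac)

lemma psd_outer: "psd (outer v)"
  by (simp add: psd_def outer_mult_vector inner_commute)

lemma psd_zero: "psd 0"
  by (simp add: psd_def transpose_def vec_eq_iff)

lemma psd_add: "psd A \<Longrightarrow> psd B \<Longrightarrow> psd (A + B)"
  by (simp add: psd_def transpose_def vec_eq_iff matrix_vector_mult_add_rdistrib inner_add_right)

lemma psd_scaleR: "0 \<le> u \<Longrightarrow> psd A \<Longrightarrow> psd (u *\<^sub>R A)"
  by (simp add: psd_def transpose_def vec_eq_iff flip: scaleR_matrix_vector_assoc)

lemma inner_symmetric_swap:
  fixes A :: "real^'k^'k"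
  assumes "transpose A = A"
  shows "v \<bullet> (A *v w) = w \<bullet> (A *v v)"
  by (metis assms dot_lmul_matrix inner_commute transpose_matrix_vector)

lemma psd_quadratic_on_line:
  assumes "psd A"
  shows "0 \<le> w \<bullet> (A *v w) + 2 * s * (v \<bullet> (A *v w)) + s\<^sup>2 * (v \<bullet> (A *v v))"
proof -
  have "0 \<le> (w + s *\<^sub>R v) \<bullet> (A *v (w + s *\<^sub>R v))"
    using assms by (auto simp: psd_def)
  also have "\<dots> = w \<bullet> (A *v w) + 2 * s * (v \<bullet> (A *v w)) + s\<^sup>2 * (v \<bullet> (A *v v))"
    using inner_symmetric_swap[of A w v] assms
    by (simp add: psd_def matrix_vector_right_distrib matrix_vector_mult_scaleR
        inner_add_left inner_add_right power2_eq_square algebra_simps)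
  finally show ?thesis .
qed

lemma axis_inner_matrix_axis: "axis i 1 \<bullet> (A *v axis j 1) = A $ i $ j"
  for A :: "real^'k^'k"
  by (simp add: inner_axis' matrix_vector_mult_basis column_def)

lemma psd_diagonal_nonneg: "psd A \<Longrightarrow> 0 \<le> A $ i $ i"
  by (metis axis_inner_matrix_axis psd_def)

lemma psd_entry_sym:
  assumes "psd A"
  shows "A $ i $ j = A $ j $ i"
proof -
  have "transpose A $ j $ i = A $ j $ i" using assms by (simp add: psd_def)
  then show ?thesis by (simp add: transpose_nth)
qed

lemma psd_zero_diagonal_entry:
  assumes "psd A" and "A $ i $ i = 0"
  shows "A $ i $ j = 0"
proof (rule ccontr)
  assume nz: "A $ i $ j \<noteq> 0"
  \<comment> \<open>Along \<open>axis j 1 + s *\<^sub>R axis i 1\<close> the quadratic form is affine in \<open>s\<close> with slope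
    \<open>2 * A $ i $ j\<close>; this \<open>s\<close> makes its value \<open>- 1\<close>.\<close>
  define s where "s = - (A $ j $ j + 1) / (2 * A $ i $ j)"
  have "0 \<le> A $ j $ j + 2 * s * A $ i $ j"
    using psd_quadratic_on_line[OF assms(1), of "axis j 1" s "axis i 1"] assms(2)
    by (simp add: axis_inner_matrix_axis)
  also have "\<dots> = - 1"
    using nz by (simp add: s_def field_simps)
  finally show False by simp
qed

lemma psd_zero_diagonal:
  assumes "psd A" and "\<And>i. A $ i $ i = 0"
  shows "A = 0"
  using psd_zero_diagonal_entry[OF assms(1)] assms(2) by (simp add: vec_eq_iff)

lemma psd_schur_complement:
  assumes "psd A" and "0 < A $ i $ i"
  shows "psd (A - (1 / A $ i $ i) *\<^sub>R outer (A *v axis i 1))"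
proof -
  let ?v = "A *v axis i 1" and ?d = "A $ i $ i"
  have sym: "transpose A = A" using assms(1) by (simp add: psd_def)
  have "0 \<le> w \<bullet> ((A - (1 / ?d) *\<^sub>R outer ?v) *v w)" for w
  proof -
    have swap: "axis i 1 \<bullet> (A *v w) = ?v \<bullet> w"
      using inner_symmetric_swap[OF sym] by (metis inner_commute)
    have "0 \<le> w \<bullet> (A *v w) + 2 * (- (?v \<bullet> w) / ?d) * (?v \<bullet> w) + (- (?v \<bullet> w) / ?d)\<^sup>2 * ?d"
      using psd_quadratic_on_line[OF assms(1), of w "- (?v \<bullet> w) / ?d" "axis i 1"]
      by (simp only: axis_inner_matrix_axis swap)
    also have "\<dots> = w \<bullet> (A *v w) - (?v \<bullet> w)\<^sup>2 / ?d"
      using assms(2) by (simp add: power2_eq_square field_simps)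
    also have "\<dots> = w \<bullet> ((A - (1 / ?d) *\<^sub>R outer ?v) *v w)"
      by (simp add: matrix_vector_mult_diff_rdistrib outer_mult_vector inner_diff_right
          power2_eq_square inner_commute flip: scaleR_matrix_vector_assoc)
    finally show ?thesis .
  qed
  moreover have "transpose (A - (1 / ?d) *\<^sub>R outer ?v) = A - (1 / ?d) *\<^sub>R outer ?v"
    by (simp only: linear_diff[OF linear_transpose] linear_scale[OF linear_transpose]
        transpose_outer sym)
  ultimately show ?thesis by (simp add: psd_def)
qed

text \<open>
  Symmetric Gaussian elimination writes \<open>A\<close> as a nonnegative combination of matrices \<open>outer v\<close>,
  and \<open>outer v \<bullet> Y = v \<bullet> (Y *v v)\<close>. Each elimination step makes one more row vanish and
  keeps the rows that already vanish, so the number of nonzero rows decreases.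
\<close>

lemma psd_inner_nonneg:
  fixes A Y :: "real^'k^'k"
  assumes "psd A" and "psd Y"
  shows "0 \<le> A \<bullet> Y"
  using assms(1)
proof (induction "card {k. A $ k \<noteq> 0}" arbitrary: A rule: less_induct)
  case less
  show ?case
  proof (cases "\<forall>i. A $ i $ i = 0")
    case True
    then show ?thesis using psd_zero_diagonal[OF less.prems] by simp
  next
    case False
    then obtain i where "A $ i $ i \<noteq> 0" by blast
    then have pos: "0 < A $ i $ i"
      using psd_diagonal_nonneg[OF less.prems, of i] by simp
    let ?v = "A *v axis i 1"
    define A' where "A' = A - (1 / A $ i $ i) *\<^sub>R outer ?v"
    have v: "?v $ k = A $ k $ i" for k
      by (simp add: matrix_vector_mult_basis column_def)
    have entry: "A' $ k $ l = A $ k $ l - A $ k $ i * A $ l $ i / A $ i $ i" for k l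
      by (simp add: A'_def outer_def v)
    have "A' $ i = 0"
      using pos psd_entry_sym[OF less.prems] by (simp add: entry vec_eq_iff)
    moreover have "A' $ k = 0" if "A $ k = 0" for k
      using that by (simp add: entry vec_eq_iff)
    moreover have "A $ i \<noteq> 0" using pos by auto
    ultimately have "{k. A' $ k \<noteq> 0} \<subset> {k. A $ k \<noteq> 0}" by blast
    then have "card {k. A' $ k \<noteq> 0} < card {k. A $ k \<noteq> 0}"
      by (intro psubset_card_mono) auto
    moreover have "psd A'"
      unfolding A'_def by (rule psd_schur_complement[OF less.prems pos])
    ultimately have "0 \<le> A' \<bullet> Y" by (rule less.hyps)
    moreover have "0 \<le> outer ?v \<bullet> Y"
      using assms(2) by (simp add: inner_outer psd_def)
    moreover have "A \<bullet> Y = A' \<bullet> Y + (1 / A $ i $ i) * (outer ?v \<bullet> Y)"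
      by (simp add: A'_def inner_diff_left)
    ultimately show ?thesis using pos by simp
  qed
qed

lemma nonneg_mat_inner_nonneg: "nonneg_mat A \<Longrightarrow> nonneg_mat Y \<Longrightarrow> 0 \<le> A \<bullet> Y"
  unfolding inner_matrix_sum nonneg_mat_def by (intro sum_nonneg) simp


section \<open>Bordered matrices\<close>

lemma sum_option: "(\<Sum>i\<in>UNIV. f i) = f None + (\<Sum>i\<in>UNIV. f (Some i))"
  for f :: "'n::finite option \<Rightarrow> real"
  by (simp add: UNIV_option_conv sum.reindex)

lemma bordered_nth [simp]:
  "bordered \<alpha> v M $ None $ None = \<alpha>"
  "bordered \<alpha> v M $ None $ Some l = v $ l"
  "bordered \<alpha> v M $ Some k $ None = v $ k"
  "bordered \<alpha> v M $ Some k $ Some l = M $ k $ l"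
  by (simp_all add: bordered_def)

lemma bordered_inner:
  "bordered \<alpha> v M \<bullet> bordered \<beta> w N = \<alpha> * \<beta> + 2 * (v \<bullet> w) + M \<bullet> N"
  unfolding inner_matrix_sum
  by (simp add: sum_option sum.distrib inner_vec_def)

lemma option_matrix_eq_iff:
  "A = A' \<longleftrightarrow> A $ None $ None = A' $ None $ None \<and>
     (\<forall>l. A $ None $ Some l = A' $ None $ Some l) \<and>
     (\<forall>k. A $ Some k $ None = A' $ Some k $ None) \<and>
     (\<forall>k l. A $ Some k $ Some l = A' $ Some k $ Some l)"
  for A A' :: "real^('n::finite option)^('n option)"
  unfolding vec_eq_iff by (metis option.exhaust)

lemma transpose_bordered:
  "transpose (bordered \<alpha> v M) = bordered \<alpha> v (transpose M)"
  by (simp add: option_matrix_eq_iff transpose_nth)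

lemma symmetric_bordered_cases:
  assumes "transpose Y = Y"
  obtains \<alpha> x X where "Y = bordered \<alpha> x X" and "transpose X = X"
proof
  have sym: "Y $ i $ j = Y $ j $ i" for i j
    by (metis assms transpose_nth)
  show "Y = bordered (Y $ None $ None) (\<chi> k. Y $ None $ Some k) (\<chi> k l. Y $ Some k $ Some l)"
    using sym by (simp add: option_matrix_eq_iff)
  show "transpose (\<chi> k l. Y $ Some k $ Some l) = (\<chi> k l. Y $ Some k $ Some l)"
    using sym by (simp add: transpose_def vec_eq_iff)
qed

lemma scaleR_bordered: "u *\<^sub>R bordered \<alpha> v M = bordered (u * \<alpha>) (u *\<^sub>R v) (u *\<^sub>R M)"
  by (simp add: option_matrix_eq_iff)

lemma trace_transpose_mult: "trace (transpose A ** X) = A \<bullet> X"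
  for A X :: "real^'n^'n"
  unfolding trace_def matrix_matrix_mult_def transpose_def inner_matrix_sum
  by (simp, rule sum.swap)

lemma trace_outer_mult: "trace (outer v ** X) = outer v \<bullet> X"
  by (metis trace_transpose_mult transpose_outer)

lemma outer_axis_inner: "outer (axis i 1) \<bullet> X = X $ i $ i"
  for X :: "real^'n^'n"
  by (simp add: inner_outer axis_inner_matrix_axis)

lemma sdp_objective_eq_inner:
  "sdp_objective Q c x X = bordered 0 ((1/2) *\<^sub>R c) Q \<bullet> bordered 1 x X"
  by (simp add: sdp_objective_def trace_transpose_mult bordered_inner)


section \<open>Weak duality\<close>

text \<open>
  With \<open>C = bordered 0 ((1/2) *\<^sub>R c) Q\<close>, dual feasibility is the equation
  \<open>C = dual_matrix a B \<Psi>\<close> together with homogeneous constraints \<open>dual_cone B \<Psi>\<close>. Both parts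
  are compatible with sums and nonnegative multiples, which the separation argument uses.
\<close>

fun dual_matrix ::
  "('m::finite \<Rightarrow> real^'n) \<Rightarrow> 'n set \<Rightarrow> ('n, 'm) dual_vars \<Rightarrow> real^('n option)^('n option)" where
  "dual_matrix a B (\<gamma>, \<omega>, \<phi>, \<kappa>, \<mu>, \<Omega>, \<Theta>) =
       (\<Sum>j\<in>UNIV. \<gamma> $ j *\<^sub>R bordered 0 ((1/2) *\<^sub>R a j) 0)
     + (\<Sum>j\<in>UNIV. \<omega> $ j *\<^sub>R bordered 0 0 (outer (a j)))
     + (\<Sum>i\<in>B. \<kappa> $ i *\<^sub>R bordered 0 ((1/2) *\<^sub>R axis i 1) (- outer (axis i 1)))
     + (\<Sum>i\<in>-B. \<phi> $ i *\<^sub>R bordered 0 0 (outer (axis i 1)))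
     + \<mu> *\<^sub>R bordered 1 0 0 + \<Theta> + \<Omega>"

fun dual_cone :: "'n set \<Rightarrow> ('n::finite, 'm::finite) dual_vars \<Rightarrow> bool" where
  "dual_cone B (\<gamma>, \<omega>, \<phi>, \<kappa>, \<mu>, \<Omega>, \<Theta>) \<longleftrightarrow>
     (\<forall>i\<in>-B. \<phi> $ i \<le> 0) \<and> transpose \<Theta> = \<Theta> \<and> nonneg_mat \<Theta> \<and> psd \<Omega>"

lemma dual_feasible_iff:
  "dual_feasible Q c a B \<Psi> \<longleftrightarrow>
     dual_cone B \<Psi> \<and> bordered 0 ((1/2) *\<^sub>R c) Q = dual_matrix a B \<Psi>"
  by (cases \<Psi>) (auto simp: algebra_simps)

lemma dual_matrix_inner_bordered:
  "dual_matrix a B (\<gamma>, \<omega>, \<phi>, \<kappa>, \<mu>, \<Omega>, \<Theta>) \<bullet> bordered \<alpha> x X =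
     (\<Sum>j\<in>UNIV. \<gamma> $ j * (a j \<bullet> x)) + (\<Sum>j\<in>UNIV. \<omega> $ j * (outer (a j) \<bullet> X))
     + (\<Sum>i\<in>B. \<kappa> $ i * (x $ i - X $ i $ i)) + (\<Sum>i\<in>-B. \<phi> $ i * X $ i $ i)
     + \<mu> * \<alpha> + \<Theta> \<bullet> bordered \<alpha> x X + \<Omega> \<bullet> bordered \<alpha> x X"
  by (simp add: inner_add_left inner_sum_left bordered_inner outer_axis_inner inner_axis')

text \<open>
  The gap between the objectives is \<open>\<Theta> \<bullet> Y + \<Omega> \<bullet> Y\<close> with \<open>Y = bordered 1 x X\<close>, plus the slack of
  the upper bounds on the diagonal weighted by \<open>- \<phi>\<close>.
\<close>

lemma weak_duality:
  assumes P: "sdp_feasible a b B U s x X" and D: "dual_feasible Q c a B \<Psi>"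
  shows "dual_objective b B U \<Psi> s \<le> sdp_objective Q c x X"
proof -
  obtain \<gamma> \<omega> \<phi> \<kappa> \<mu> \<Omega> \<Theta> where \<Psi>: "\<Psi> = (\<gamma>, \<omega>, \<phi>, \<kappa>, \<mu>, \<Omega>, \<Theta>)"
    by (cases \<Psi>)
  have C: "bordered 0 ((1/2) *\<^sub>R c) Q = dual_matrix a B (\<gamma>, \<omega>, \<phi>, \<kappa>, \<mu>, \<Omega>, \<Theta>)"
    and cone: "dual_cone B (\<gamma>, \<omega>, \<phi>, \<kappa>, \<mu>, \<Omega>, \<Theta>)"
    using D unfolding \<Psi> dual_feasible_iff by blast+
  have "(\<Sum>i\<in>-B. (U i)\<^sup>2 * \<phi> $ i) \<le> (\<Sum>i\<in>-B. \<phi> $ i * X $ i $ i)"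
    using P cone by (intro sum_mono) (auto simp: sdp_feasible_def mult.commute intro: mult_left_mono_neg)
  moreover have "(\<Sum>i\<in>B. \<kappa> $ i * (x $ i - X $ i $ i)) = 0"
    using P by (intro sum.neutral) (simp add: sdp_feasible_def)
  moreover have "0 \<le> \<Theta> \<bullet> bordered 1 x X" "0 \<le> \<Omega> \<bullet> bordered 1 x X"
    using P cone by (auto simp: sdp_feasible_def intro: nonneg_mat_inner_nonneg psd_inner_nonneg)
  moreover have "\<And>j. a j \<bullet> x = b j s" "\<And>j. outer (a j) \<bullet> X = (b j s)\<^sup>2"
    using P by (simp_all add: sdp_feasible_def trace_outer_mult)
  ultimately show ?thesis
    unfolding sdp_objective_eq_inner C dual_matrix_inner_bordered
    by (simp add: \<Psi> sum.distrib)
qed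

lemma dual_objective_le_sdp_value:
  assumes "dual_feasible Q c a B \<Psi>"
  shows "ereal (dual_objective b B U \<Psi> s) \<le> sdp_value Q c a b B U s"
  unfolding sdp_value_def using weak_duality[OF _ assms] by (auto intro!: INF_greatest)


section \<open>Strong duality\<close>

text \<open>
  A hyperplane that separates a point from a cone can be moved to the apex. The inequality at \<open>p\<close>
  cannot be strict in general, since \<open>p\<close> may lie in the closure of \<open>W\<close>.
\<close>

lemma separating_hyperplane_cone_point:
  fixes W :: "'e::euclidean_space set"
  assumes "convex_cone W" "p \<notin> W"
  obtains y where "y \<noteq> 0" "y \<bullet> p \<le> 0" "\<And>w. w \<in> W \<Longrightarrow> 0 \<le> y \<bullet> w"
proof -
  obtain y h where y: "y \<noteq> 0" "y \<bullet> p \<le> h" "\<And>w. w \<in> W \<Longrightarrow> h \<le> y \<bullet> w"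
    using separating_hyperplane_sets[of "{p}" W] assms by (auto simp: convex_cone_def)
  have "0 \<in> W" using assms(1) by (simp add: convex_cone_iff)
  then have h: "h \<le> 0" using y(3) by fastforce
  \<comment> \<open>If \<open>y \<bullet> w < 0\<close>, a multiple of \<open>w\<close> reaches the value \<open>h - 1\<close>, below the bound \<open>h\<close> on the cone.\<close>
  have "0 \<le> y \<bullet> w" if w: "w \<in> W" for w
  proof (rule ccontr)
    assume "\<not> 0 \<le> y \<bullet> w"
    then have neg: "y \<bullet> w < 0" by simp
    have "(h - 1) / (y \<bullet> w) \<ge> 0" using h neg by (simp add: divide_nonpos_neg)
    then have "h \<le> y \<bullet> (((h - 1) / (y \<bullet> w)) *\<^sub>R w)"
      using assms(1) w y(3) by (simp only: convex_cone_scaleR)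
    then show False using neg by simp
  qed
  with y h show ?thesis by (intro that[of y]) auto
qed

lemma dual_matrix_linear: "linear (dual_matrix a B)"
proof (rule linearI)
  show "dual_matrix a B (\<Psi> + \<Psi>') = dual_matrix a B \<Psi> + dual_matrix a B \<Psi>'" for \<Psi> \<Psi>'
    by (cases \<Psi>; cases \<Psi>') (simp add: scaleR_add_left sum.distrib)
  show "dual_matrix a B (u *\<^sub>R \<Psi>) = u *\<^sub>R dual_matrix a B \<Psi>" for u \<Psi>
    by (cases \<Psi>) (simp add: scaleR_add_right scaleR_sum_right)
qed

lemma dual_objective_linear: "linear (\<lambda>\<Psi>. dual_objective b B U \<Psi> s)"
proof (rule linearI)
  show "dual_objective b B U (\<Psi> + \<Psi>') s =
      dual_objective b B U \<Psi> s + dual_objective b B U \<Psi>' s" for \<Psi> \<Psi>'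
    by (cases \<Psi>; cases \<Psi>') (simp add: distrib_left distrib_right sum.distrib)
  show "dual_objective b B U (u *\<^sub>R \<Psi>) s = u *\<^sub>R dual_objective b B U \<Psi> s" for u \<Psi>
    by (cases \<Psi>) (simp add: distrib_left sum_distrib_left mult_ac)
qed

lemma dual_cone_zero: "dual_cone B (0 :: ('n::finite, 'm::finite) dual_vars)"
  by (simp add: zero_prod_def nonneg_mat_def psd_zero linear_0[OF linear_transpose])

lemma dual_cone_add: "dual_cone B \<Psi> \<Longrightarrow> dual_cone B \<Psi>' \<Longrightarrow> dual_cone B (\<Psi> + \<Psi>')"
  by (cases \<Psi>; cases \<Psi>')
    (auto simp: nonneg_mat_def psd_add transpose_def vec_eq_iff intro: add_nonpos_nonpos)

lemma dual_cone_scaleR: "0 \<le> u \<Longrightarrow> dual_cone B \<Psi> \<Longrightarrow> dual_cone B (u *\<^sub>R \<Psi>)"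
  by (cases \<Psi>)
    (auto simp: nonneg_mat_def psd_scaleR transpose_def vec_eq_iff mult_nonneg_nonpos)

lemma dual_matrix_symmetric:
  assumes "dual_cone B \<Psi>"
  shows "transpose (dual_matrix a B \<Psi>) = dual_matrix a B \<Psi>"
  using assms
  by (cases \<Psi>) (simp add: linear_add[OF linear_transpose] linear_sum[OF linear_transpose]
      linear_scale[OF linear_transpose] linear_neg[OF linear_transpose]
      linear_0[OF linear_transpose] transpose_bordered psd_def)

text \<open>
  The skew summand \<open>S\<close> makes every normal of a supporting hyperplane symmetric; it vanishes
  whenever the matrix component is itself symmetric.
\<close>

definition dual_value_cone ::
  "('m::finite \<Rightarrow> real^'n) \<Rightarrow> ('m \<Rightarrow> real \<Rightarrow> real) \<Rightarrow> 'n set \<Rightarrow> ('n \<Rightarrow> real) \<Rightarrow> real \<Rightarrow>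
   ((real^('n option)^('n option)) \<times> real) set" where
  "dual_value_cone a b B U s = {(dual_matrix a B \<Psi> + S, r) |\<Psi> S r.
     dual_cone B \<Psi> \<and> transpose S = - S \<and> r \<le> dual_objective b B U \<Psi> s}"

lemma dual_value_cone_add:
  assumes "p \<in> dual_value_cone a b B U s" "q \<in> dual_value_cone a b B U s"
  shows "p + q \<in> dual_value_cone a b B U s"
proof -
  obtain \<Psi> S r where p: "p = (dual_matrix a B \<Psi> + S, r)" "dual_cone B \<Psi>" "transpose S = - S"
      "r \<le> dual_objective b B U \<Psi> s"
    using assms(1) unfolding dual_value_cone_def by blast
  obtain \<Psi>' S' r' where q: "q = (dual_matrix a B \<Psi>' + S', r')" "dual_cone B \<Psi>'"
      "transpose S' = - S'" "r' \<le> dual_objective b B U \<Psi>' s"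
    using assms(2) unfolding dual_value_cone_def by blast
  have "p + q = (dual_matrix a B (\<Psi> + \<Psi>') + (S + S'), r + r')"
    by (simp add: p(1) q(1) linear_add[OF dual_matrix_linear])
  moreover have "dual_cone B (\<Psi> + \<Psi>')" using p(2) q(2) by (rule dual_cone_add)
  moreover have "transpose (S + S') = - (S + S')"
    using p(3) q(3) by (simp add: linear_add[OF linear_transpose])
  moreover have "r + r' \<le> dual_objective b B U (\<Psi> + \<Psi>') s"
    using p(4) q(4) by (simp add: linear_add[OF dual_objective_linear])
  ultimately show ?thesis unfolding dual_value_cone_def by blast
qed

lemma dual_value_cone_scaleR:
  assumes "p \<in> dual_value_cone a b B U s" "0 \<le> u"
  shows "u *\<^sub>R p \<in> dual_value_cone a b B U s"
proof -
  obtain \<Psi> S r where p: "p = (dual_matrix a B \<Psi> + S, r)" "dual_cone B \<Psi>" "transpose S = - S"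
      "r \<le> dual_objective b B U \<Psi> s"
    using assms(1) unfolding dual_value_cone_def by blast
  have "u *\<^sub>R p = (dual_matrix a B (u *\<^sub>R \<Psi>) + u *\<^sub>R S, u * r)"
    by (simp add: p(1) linear_scale[OF dual_matrix_linear] scaleR_add_right)
  moreover have "dual_cone B (u *\<^sub>R \<Psi>)" using assms(2) p(2) by (rule dual_cone_scaleR)
  moreover have "transpose (u *\<^sub>R S) = - (u *\<^sub>R S)"
    using p(3) by (simp add: linear_scale[OF linear_transpose])
  moreover have "u * r \<le> dual_objective b B U (u *\<^sub>R \<Psi>) s"
    using p(4) assms(2) by (simp add: linear_scale[OF dual_objective_linear] mult_left_mono)
  ultimately show ?thesis unfolding dual_value_cone_def by blast
qed

lemma zero_le_in_dual_value_cone: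
  assumes "r \<le> 0"
  shows "(0, r) \<in> dual_value_cone a b B U s"
proof -
  have "(dual_matrix a B 0 + 0, r) \<in> dual_value_cone a b B U s"
    unfolding dual_value_cone_def mem_Collect_eq
    by (intro exI[of _ 0] exI[of _ r] conjI refl dual_cone_zero)
      (use assms in \<open>simp_all add: linear_0[OF dual_objective_linear]
        linear_0[OF linear_transpose]\<close>)
  then show ?thesis by (simp add: linear_0[OF dual_matrix_linear])
qed

lemma dual_value_cone_convex_cone: "convex_cone (dual_value_cone a b B U s)"
  unfolding convex_cone_iff zero_prod_def
  by (simp add: zero_le_in_dual_value_cone dual_value_cone_add dual_value_cone_scaleR)

lemma symmetric_in_dual_value_cone:
  assumes "(M, r) \<in> dual_value_cone a b B U s" and "transpose M = M"
  obtains \<Psi> where "dual_cone B \<Psi>" "M = dual_matrix a B \<Psi>" "r \<le> dual_objective b B U \<Psi> s"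
proof -
  obtain \<Psi> S where p: "M = dual_matrix a B \<Psi> + S" "dual_cone B \<Psi>" "transpose S = - S"
      "r \<le> dual_objective b B U \<Psi> s"
    using assms(1) unfolding dual_value_cone_def by blast
  have "transpose S = transpose M - transpose (dual_matrix a B \<Psi>)"
    by (simp add: p(1) linear_add[OF linear_transpose])
  also have "\<dots> = S"
    using assms(2) by (simp add: dual_matrix_symmetric[OF p(2)]) (simp add: p(1))
  finally have "S = 0" using p(3) by (simp add: vec_eq_iff)
  then show ?thesis using that p by simp
qed

text \<open>
  The right-hand sides carry the factor \<open>\<tau>\<close>, so \<open>\<tau> = 1\<close> gives feasible points and \<open>\<tau> = 0\<close>
  gives directions of recession.
\<close>

definition homogeneous_feasible ::
  "('m::finite \<Rightarrow> real^'n) \<Rightarrow> ('m \<Rightarrow> real \<Rightarrow> real) \<Rightarrow> 'n set \<Rightarrow> ('n \<Rightarrow> real) \<Rightarrow> real \<Rightarrow> real \<Rightarrow>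
   real^'n \<Rightarrow> real^'n^'n \<Rightarrow> bool" where
  "homogeneous_feasible a b B U s \<tau> x X \<longleftrightarrow>
     transpose X = X \<and>
     (\<forall>j. a j \<bullet> x = \<tau> * b j s) \<and>
     (\<forall>j. outer (a j) \<bullet> X = \<tau> * (b j s)\<^sup>2) \<and>
     (\<forall>i\<in>-B. X $ i $ i \<le> \<tau> * (U i)\<^sup>2) \<and>
     (\<forall>i\<in>B. x $ i = X $ i $ i) \<and>
     psd (bordered \<tau> x X) \<and> nonneg_mat (bordered \<tau> x X)"

lemma homogeneous_feasible_scale:
  assumes "homogeneous_feasible a b B U s \<tau> x X" and "0 < \<tau>"
  shows "sdp_feasible a b B U s ((1/\<tau>) *\<^sub>R x) ((1/\<tau>) *\<^sub>R X)"
proof -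
  have eq: "bordered 1 ((1/\<tau>) *\<^sub>R x) ((1/\<tau>) *\<^sub>R X) = (1/\<tau>) *\<^sub>R bordered \<tau> x X"
    using assms(2) by (simp add: scaleR_bordered)
  have "psd ((1/\<tau>) *\<^sub>R bordered \<tau> x X)" "nonneg_mat ((1/\<tau>) *\<^sub>R bordered \<tau> x X)"
    using assms by (auto simp: homogeneous_feasible_def nonneg_mat_def intro!: psd_scaleR)
  then show ?thesis
    using assms
    by (auto simp: sdp_feasible_def homogeneous_feasible_def eq trace_outer_mult
        linear_scale[OF linear_transpose] field_simps)
qed

text \<open>
  This is the boundedness of the primal feasible set, expressed by its directions of recession. A
  positive semidefinite matrix with a zero corner has a zero border. Then the diagonal of \<open>X\<close>
  vanishes too, on \<open>B\<close> because it equals the border and on \<open>-B\<close> because of the upper bounds.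
\<close>

lemma homogeneous_feasible_zero:
  assumes "homogeneous_feasible a b B U s 0 x X"
  shows "bordered 0 x X = 0"
proof (rule psd_zero_diagonal)
  show psd: "psd (bordered 0 x X)" using assms by (simp add: homogeneous_feasible_def)
  have x: "x $ k = 0" for k
    using psd_zero_diagonal_entry[OF psd, of None "Some k"] by simp
  show "bordered 0 x X $ i $ i = 0" for i
  proof (cases i)
    case (Some k)
    have "0 \<le> X $ k $ k" using psd_diagonal_nonneg[OF psd, of "Some k"] by simp
    moreover have "X $ k $ k \<le> 0"
      using assms x by (cases "k \<in> B") (auto simp: homogeneous_feasible_def)
    ultimately show ?thesis by (simp add: Some)
  qed simp
qed

text \<open>
  Testing against each dual variable in turn recovers the primal constraints: the free variables
  give the equations and the signed ones the inequalities.
\<close>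

lemma homogeneous_feasible_of_dual_value_cone:
  fixes a :: "'m::finite \<Rightarrow> real^'n"
  assumes "\<And>p. p \<in> dual_value_cone a b B U s \<Longrightarrow> 0 \<le> (Y, - \<tau>) \<bullet> p"
  obtains x X where "Y = bordered \<tau> x X" "homogeneous_feasible a b B U s \<tau> x X"
proof -
  have test: "\<tau> * dual_objective b B U \<Psi> s \<le> Y \<bullet> (dual_matrix a B \<Psi> + S)"
    if "dual_cone B \<Psi>" "transpose S = - S" for \<Psi> S
  proof -
    have "(dual_matrix a B \<Psi> + S, dual_objective b B U \<Psi> s) \<in> dual_value_cone a b B U s"
      unfolding dual_value_cone_def using that by blast
    from assms[OF this] show ?thesis by simp
  qed
  have zero: "transpose (0 :: real^('n option)^('n option)) = - 0"
    by (simp add: linear_0[OF linear_transpose])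
  have "transpose Y = Y"
  proof -
    let ?S = "transpose Y - Y"
    have "transpose ?S = - ?S" by (simp add: linear_diff[OF linear_transpose])
    then have "0 \<le> Y \<bullet> ?S"
      using test[OF dual_cone_zero, of ?S]
      by (simp add: linear_0[OF dual_matrix_linear] linear_0[OF dual_objective_linear])
    moreover have "?S \<bullet> ?S = - 2 * (Y \<bullet> ?S)"
      using inner_transpose_transpose[of Y Y]
      by (simp add: inner_diff_left inner_diff_right inner_commute algebra_simps)
    ultimately have "?S \<bullet> ?S = 0" using inner_ge_zero[of ?S] by linarith
    then show ?thesis by simp
  qed
  then obtain \<alpha> x X where Y: "Y = bordered \<alpha> x X" and X: "transpose X = X"
    by (rule symmetric_bordered_cases)
  have test': "\<tau> * dual_objective b B U (\<gamma>, \<omega>, \<phi>, \<kappa>, \<mu>, \<Omega>, \<Theta>) s \<le>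
     (\<Sum>j\<in>UNIV. \<gamma> $ j * (a j \<bullet> x)) + (\<Sum>j\<in>UNIV. \<omega> $ j * (outer (a j) \<bullet> X))
     + (\<Sum>i\<in>B. \<kappa> $ i * (x $ i - X $ i $ i)) + (\<Sum>i\<in>-B. \<phi> $ i * X $ i $ i)
     + \<mu> * \<alpha> + \<Theta> \<bullet> bordered \<alpha> x X + \<Omega> \<bullet> bordered \<alpha> x X"
    if "dual_cone B (\<gamma>, \<omega>, \<phi>, \<kappa>, \<mu>, \<Omega>, \<Theta>)" for \<gamma> \<omega> \<phi> \<kappa> \<mu> \<Omega> \<Theta>
    using test[OF that zero] unfolding Y dual_matrix_inner_bordered[symmetric]
    by (simp add: inner_commute del: dual_matrix.simps dual_objective.simps)
  have nz: "nonneg_mat (0 :: real^('n option)^('n option))"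
    by (simp add: nonneg_mat_def)
  have sum_axis: "(\<Sum>i\<in>I. axis k u $ i * f i) = (if k \<in> I then u * f k else 0)"
    "(\<Sum>i\<in>I. f i * axis k u $ i) = (if k \<in> I then u * f k else 0)"
    for I and k :: "'k::finite" and u and f :: "'k \<Rightarrow> real"
    by (simp_all add: axis_def if_distrib[of "\<lambda>z. z * _"] if_distrib[of "\<lambda>z. _ * z"] cong: if_cong)
  note simps = nz zero psd_zero sum_axis sum.distrib
  have corner: "\<alpha> = \<tau>"
    using test'[of 0 0 0 0 1 0 0] test'[of 0 0 0 0 "-1" 0 0] by (simp add: simps)
  have "a j \<bullet> x = \<tau> * b j s" for j
    using test'[of "axis j 1" 0 0 0 0 0 0] test'[of "axis j (-1)" 0 0 0 0 0 0]
    by (simp add: simps)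
  moreover have "outer (a j) \<bullet> X = \<tau> * (b j s)\<^sup>2" for j
    using test'[of 0 "axis j 1" 0 0 0 0 0] test'[of 0 "axis j (-1)" 0 0 0 0 0]
    by (simp add: simps)
  moreover have "X $ i $ i \<le> \<tau> * (U i)\<^sup>2" if "i \<in> - B" for i
    using test'[of 0 0 "axis i (-1)" 0 0 0 0] that by (simp add: simps) (simp add: axis_def)
  moreover have "x $ i = X $ i $ i" if "i \<in> B" for i
    using test'[of 0 0 0 "axis i 1" 0 0 0] test'[of 0 0 0 "axis i (-1)" 0 0 0] that
    by (simp add: simps)
  moreover have "psd (bordered \<tau> x X)"
  proof -
    have "0 \<le> v \<bullet> (bordered \<tau> x X *v v)" for v
      using test'[of 0 0 0 0 0 "outer v" 0]
      by (simp add: simps psd_outer inner_outer corner)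
    then show ?thesis by (simp add: psd_def transpose_bordered X)
  qed
  moreover have "nonneg_mat (bordered \<tau> x X)"
  proof -
    have "0 \<le> bordered \<tau> x X $ i $ j" for i j
    proof -
      \<comment> \<open>The unit matrix at position \<open>(i, j)\<close>, symmetrised.\<close>
      let ?E = "axis i (axis j 1) + axis j (axis i 1) :: real^('n option)^('n option)"
      have "?E \<bullet> bordered \<tau> x X = bordered \<tau> x X $ i $ j + bordered \<tau> x X $ j $ i"
        by (simp add: inner_add_left inner_axis')
      moreover have "bordered \<tau> x X $ j $ i = bordered \<tau> x X $ i $ j"
        by (metis X transpose_bordered transpose_nth)
      moreover have "dual_cone B (0 :: real^'m, 0 :: real^'m, 0, 0, 0, 0, ?E)"
        by (auto simp: nonneg_mat_def psd_zero transpose_def vec_eq_iff axis_def)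
      ultimately show ?thesis
        using test'[of 0 0 0 0 0 0 ?E] by (simp add: corner)
    qed
    then show ?thesis by (simp add: nonneg_mat_def)
  qed
  ultimately have "homogeneous_feasible a b B U s \<tau> x X"
    using X by (auto simp: homogeneous_feasible_def)
  then show ?thesis using that Y corner by blast
qed

text \<open>
  Let \<open>C\<close> be the cost matrix. If \<open>(C, r)\<close> lies in \<open>dual_value_cone a b B U s\<close>, then a dual
  feasible point reaches \<open>r\<close>. Otherwise there is a separating normal \<open>(Y, - \<tau>)\<close>. For
  \<open>\<tau> > 0\<close> the matrix \<open>(1 / \<tau>) *\<^sub>R Y\<close> is a primal feasible point of value at most \<open>r\<close>. The case
  \<open>\<tau> = 0\<close> cannot occur, because the only direction of recession is \<open>0\<close> while the normal is
  nonzero; boundedness of the primal feasible set takes the place of a Slater condition.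
\<close>

lemma primal_or_dual_bound:
  assumes "transpose Q = Q"
  shows "(\<exists>x X. sdp_feasible a b B U s x X \<and> sdp_objective Q c x X \<le> r) \<or>
    (\<exists>\<Psi>. dual_feasible Q c a B \<Psi> \<and> r \<le> dual_objective b B U \<Psi> s)"
proof (cases "(bordered 0 ((1/2) *\<^sub>R c) Q, r) \<in> dual_value_cone a b B U s")
  case True
  moreover have "transpose (bordered 0 ((1/2) *\<^sub>R c) Q) = bordered 0 ((1/2) *\<^sub>R c) Q"
    by (simp add: transpose_bordered assms)
  ultimately show ?thesis
    by (metis dual_feasible_iff symmetric_in_dual_value_cone)
next
  case False
  let ?W = "dual_value_cone a b B U s" and ?C = "bordered 0 ((1/2) *\<^sub>R c) Q"
  obtain y where y: "y \<noteq> 0" "y \<bullet> (?C, r) \<le> 0" "\<And>w. w \<in> ?W \<Longrightarrow> 0 \<le> y \<bullet> w"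
    using separating_hyperplane_cone_point[OF dual_value_cone_convex_cone False] by blast
  obtain Y t where yt: "y = (Y, t)" by (cases y)
  define \<tau> where "\<tau> = - t"
  have y\<tau>: "y = (Y, - \<tau>)" by (simp add: yt \<tau>_def)
  have \<tau>: "0 \<le> \<tau>" using y(3)[OF zero_le_in_dual_value_cone[of "-1"]] by (simp add: y\<tau>)
  obtain x X where Y: "Y = bordered \<tau> x X" and hom: "homogeneous_feasible a b B U s \<tau> x X"
    using homogeneous_feasible_of_dual_value_cone y(3) unfolding y\<tau> by blast
  have "\<tau> \<noteq> 0"
    using y(1) hom homogeneous_feasible_zero[of a b B U s x X] by (auto simp: y\<tau> Y zero_prod_def)
  with \<tau> have pos: "0 < \<tau>" by simp
  have "sdp_objective Q c ((1/\<tau>) *\<^sub>R x) ((1/\<tau>) *\<^sub>R X) = (?C \<bullet> Y) / \<tau>"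
    using pos by (simp add: sdp_objective_eq_inner Y bordered_inner add_divide_distrib)
  also have "\<dots> \<le> r"
    using y(2) pos by (simp add: y\<tau> inner_commute field_simps)
  finally show ?thesis using homogeneous_feasible_scale[OF hom pos] by blast
qed

text \<open>
  No dual feasible point reaches a value \<open>r\<close> above the dual optimum, so the primal alternative holds
  for every such \<open>r\<close>.
\<close>

lemma sdp_value_eq_dual_optimum:
  assumes "transpose Q = Q" and "dual_optimal Q c a b B U s \<Psi>"
  shows "sdp_value Q c a b B U s = ereal (dual_objective b B U \<Psi> s)"
proof (rule antisym)
  show "ereal (dual_objective b B U \<Psi> s) \<le> sdp_value Q c a b B U s"
    using assms(2) by (simp add: dual_optimal_def dual_objective_le_sdp_value)
  show "sdp_value Q c a b B U s \<le> ereal (dual_objective b B U \<Psi> s)"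
  proof (rule ereal_le_epsilon2)
    fix e :: real assume "0 < e"
    let ?r = "dual_objective b B U \<Psi> s + e"
    have "\<not> (\<exists>\<Psi>'. dual_feasible Q c a B \<Psi>' \<and> ?r \<le> dual_objective b B U \<Psi>' s)"
      using assms(2) \<open>0 < e\<close> by (fastforce simp: dual_optimal_def)
    then obtain x X where "sdp_feasible a b B U s x X" "sdp_objective Q c x X \<le> ?r"
      using primal_or_dual_bound[OF assms(1)] by blast
    then show "sdp_value Q c a b B U s \<le> ereal (dual_objective b B U \<Psi> s) + ereal e"
      unfolding sdp_value_def by (auto intro!: INF_lower2[of "(x, X)"])
  qed
qed


section \<open>The value function above a fixed dual objective\<close>

lemma dual_objective_differentiable:
  assumes "\<And>j. b j differentiable (at t)"
  shows "(dual_objective b B U \<Psi> has_real_derivative deriv (dual_objective b B U \<Psi>) t) (at t)"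
proof -
  obtain \<gamma> \<omega> \<phi> \<kappa> \<mu> \<Omega> \<Theta> where \<Psi>: "\<Psi> = (\<gamma>, \<omega>, \<phi>, \<kappa>, \<mu>, \<Omega>, \<Theta>)"
    by (cases \<Psi>)
  have "(\<lambda>t. dual_objective b B U \<Psi> t) differentiable (at t)"
    using assms by (simp add: \<Psi>)
  then show ?thesis
    by (simp add: DERIV_deriv_iff_real_differentiable)
qed

text \<open>
  Here \<open>g\<close> is the difference of the real parts of \<open>V\<close> and \<open>f\<close>. Finiteness of \<open>V\<close> near \<open>t\<close> is
  essential for its sign: \<open>real_of_ereal\<close> sends \<open>\<infinity>\<close> to \<open>0\<close>, which may be less than \<open>f\<close>.
\<close>

lemma finite_derivative_minorant:
  assumes V: "has_finite_derivative_within V D t S" and f: "(f has_real_derivative d) (at t)"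
    and below: "\<And>s. ereal (f s) \<le> V s" and touch: "V t = ereal (f t)" and t: "t \<in> S"
  obtains g where "(g has_real_derivative D - d) (at t within S)" "g t = 0"
    "\<forall>\<^sub>F s in at t within S. 0 \<le> g s"
proof
  let ?g = "\<lambda>s. real_of_ereal (V s) - f s"
  show "(?g has_real_derivative D - d) (at t within S)"
    using V has_field_derivative_at_within[OF f]
    by (auto simp: has_finite_derivative_within_def intro!: derivative_intros)
  show "?g t = 0" by (simp add: touch)
  obtain e where "0 < e" and e: "\<And>s. s \<in> S \<Longrightarrow> \<bar>s - t\<bar> < e \<Longrightarrow> \<bar>V s\<bar> \<noteq> \<infinity>"
    using V by (auto simp: has_finite_derivative_within_def)
  have "0 \<le> ?g s" if s: "s \<in> S" "\<bar>s - t\<bar> < e" for s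
  proof -
    obtain v where "V s = ereal v" using e[OF s] by (cases "V s") auto
    then show ?thesis using below[of s] by simp
  qed
  then show "\<forall>\<^sub>F s in at t within S. 0 \<le> ?g s"
    unfolding eventually_at dist_real_def using \<open>0 < e\<close> by blast
qed

lemma left_derivative_le_minorant:
  assumes "has_finite_derivative_within V D t {..t}" and "(f has_real_derivative d) (at t)"
    and "\<And>s. ereal (f s) \<le> V s" and "V t = ereal (f t)"
  shows "D \<le> d"
proof -
  obtain g where g: "(g has_real_derivative D - d) (at t within {..t})" "g t = 0"
    "\<forall>\<^sub>F s in at t within {..t}. 0 \<le> g s"
    using finite_derivative_minorant[OF assms] by auto
  have "((\<lambda>s. (g s - g t) / (s - t)) \<longlongrightarrow> D - d) (at t within {..t})"
    using g(1) by (simp add: has_field_derivative_iff)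
  moreover have "\<forall>\<^sub>F s in at t within {..t}. (g s - g t) / (s - t) \<le> 0"
    using g(3) by (auto simp: eventually_at g(2) intro!: divide_nonneg_nonpos)
  moreover have "at t within {..t} \<noteq> bot"
    using trivial_limit_at_left_real[of t] by (simp add: at_within_Iic_at_left)
  ultimately have "D - d \<le> 0" by (intro tendsto_upperbound)
  then show ?thesis by simp
qed

lemma right_derivative_ge_minorant:
  assumes "has_finite_derivative_within V D t {t..}" and "(f has_real_derivative d) (at t)"
    and "\<And>s. ereal (f s) \<le> V s" and "V t = ereal (f t)"
  shows "d \<le> D"
proof -
  obtain g where g: "(g has_real_derivative D - d) (at t within {t..})" "g t = 0"
    "\<forall>\<^sub>F s in at t within {t..}. 0 \<le> g s"
    using finite_derivative_minorant[OF assms] by auto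
  have "((\<lambda>s. (g s - g t) / (s - t)) \<longlongrightarrow> D - d) (at t within {t..})"
    using g(1) by (simp add: has_field_derivative_iff)
  moreover have "\<forall>\<^sub>F s in at t within {t..}. 0 \<le> (g s - g t) / (s - t)"
    using g(3) by (auto simp: eventually_at g(2))
  moreover have "at t within {t..} \<noteq> bot"
    using trivial_limit_at_right_real[of t] by (simp add: at_within_Ici_at_right)
  ultimately have "0 \<le> D - d" by (intro tendsto_lowerbound)
  then show ?thesis by simp
qed

lemma has_finite_derivative_within_subset:
  assumes "has_finite_derivative_within V D t S" and "T \<subseteq> S"
  shows "has_finite_derivative_within V D t T"
  using assms unfolding has_finite_derivative_within_def
  by (meson DERIV_subset subset_iff)


section \<open>Derivatives of the value function\<close>

theorem theorem1:
  fixes Q :: "real^'n^'n" and c :: "real^'n"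
    and a :: "'m::finite \<Rightarrow> real^'n" and b :: "'m \<Rightarrow> real \<Rightarrow> real"
    and B :: "'n set" and U :: "'n \<Rightarrow> real"
    and \<theta>_lo \<theta>_hi \<theta> :: real and \<Psi> :: "('n, 'm) dual_vars"
  assumes "psd Q"
    and "\<And>j t. b j differentiable (at t)"
    and "\<And>t x i. t \<in> {\<theta>_lo..\<theta>_hi} \<Longrightarrow> mbqp_feasible a b B t x \<Longrightarrow> i \<notin> B \<Longrightarrow> x $ i \<le> U i"
    and "\<And>t. t \<in> {\<theta>_lo..\<theta>_hi} \<Longrightarrow> \<exists>x X. sdp_feasible a b B U t x X"
    and "\<theta> \<in> {\<theta>_lo..\<theta>_hi}"
    and "dual_optimal Q c a b B U \<theta> \<Psi>"
  shows "(\<theta> > \<theta>_lo \<longrightarrow>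
           (\<forall>D. has_finite_derivative_within (sdp_value Q c a b B U) D \<theta> {..\<theta>} \<longrightarrow>
                D \<le> deriv (dual_objective b B U \<Psi>) \<theta>)) \<and>
         (\<theta> < \<theta>_hi \<longrightarrow>
           (\<forall>D. has_finite_derivative_within (sdp_value Q c a b B U) D \<theta> {\<theta>..} \<longrightarrow>
                D \<ge> deriv (dual_objective b B U \<Psi>) \<theta>)) \<and>
         (\<forall>D. has_finite_derivative_within (sdp_value Q c a b B U) D \<theta> UNIV \<longrightarrow>
              D = deriv (dual_objective b B U \<Psi>) \<theta>)"
proof -
  let ?V = "sdp_value Q c a b B U" and ?f = "dual_objective b B U \<Psi>"
  have f: "(?f has_real_derivative deriv ?f \<theta>) (at \<theta>)"
    using assms(2) by (rule dual_objective_differentiable)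
  have below: "ereal (?f s) \<le> ?V s" for s
    using assms(6) by (simp add: dual_optimal_def dual_objective_le_sdp_value)
  have touch: "?V \<theta> = ereal (?f \<theta>)"
    using assms(1,6) by (simp add: psd_def sdp_value_eq_dual_optimum)
  have left: "D \<le> deriv ?f \<theta>" if "has_finite_derivative_within ?V D \<theta> {..\<theta>}" for D
    using that f below touch by (rule left_derivative_le_minorant)
  have right: "deriv ?f \<theta> \<le> D" if "has_finite_derivative_within ?V D \<theta> {\<theta>..}" for D
    using that f below touch by (rule right_derivative_ge_minorant)
  have "D = deriv ?f \<theta>" if "has_finite_derivative_within ?V D \<theta> UNIV" for D
    using left right has_finite_derivative_within_subset[OF that] by (simp add: order_antisym)
  with left right show ?thesis by blast
qed

end
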